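(* Let $V$ be a finite-dimensional diffeological vector space. If the dimension and the codimension (in $V$) of the maximal isotropic subspace of $V$ are both positive, then $V$ admits at least one non-smooth direct sum decomposition, that is, there exist vector subspaces $V_1,V_2\subseteq V$ such that $V=V_1\oplus V_2$ as a vector space but $V$ is not the smooth direct sum of $V_1$ and $V_2$.
   Context: A domain is an open subset of some $\mathbb{R}^n$. A diffeology on a set $X$ is a collection of maps $U\to X$ from domains $U$ (called plots) that contains all constant maps, is closed under pre-composition with ordinary smooth maps between domains, and satisfies the sheaf condition (a map $U\to X$ that is locally a plot is a plot). A map between diffeological spaces is smooth if its compositions with plots are plots. A diffeological vector space is a real vector space with a diffeology for which addition and scalar multiplication are smooth ($\mathbb{R}$ carrying its standard diffeology, whose plots are the ordinary smooth maps, and products carrying the product diffeology, whose plots are the maps with both components plots). The subset diffeology on a subspace $W\subseteq V$ consists of the plots of $V$ with image in $W$. If $V=V_1\oplus V_2$ as a vector space, with $V_1,V_2$ vector subspaces, then $V$ is the smooth direct sum of $V_1$ and $V_2$ if the diffeology of $V$ coincides with the product diffeology on $V_1\oplus V_2$ relative to the subset diffeologies on $V_1$ and $V_2$ inherited from $V$; otherwise the decomposition is called non-smooth. The maximal isotropic subspace of a finite-dimensional diffeological vector space $V$ is the intersection of the kernels of all smooth linear functions $V\to\mathbb{R}$ (with $\mathbb{R}$ carrying the standard diffeology). *)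

theory Defs
  imports "HOL-Analysis.Analysis"
begin

text \<open>
  Plots have domains in \<open>\<real>\<^sup>n\<close> for all \<open>n\<close> simultaneously, so \<open>\<real>\<^sup>n\<close> is the library's
  \<^const>\<open>Euclidean_space\<close> \<open>n\<close>, the space of functions \<open>nat \<Rightarrow> real\<close> vanishing at all indices
  \<open>\<ge> n\<close>.
\<close>

definition domain_in :: "nat \<Rightarrow> (nat \<Rightarrow> real) set \<Rightarrow> bool" where
  "domain_in n U \<longleftrightarrow> openin (Euclidean_space n) U"

definition partial_deriv :: "nat \<Rightarrow> ((nat \<Rightarrow> real) \<Rightarrow> real) \<Rightarrow> (nat \<Rightarrow> real) \<Rightarrow> real" where
  "partial_deriv i f x = deriv (\<lambda>t. f (x(i := t))) (x i)"

text \<open>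
  \<open>Ck_on k n U f\<close>: on the domain \<open>U\<close> of \<open>\<real>\<^sup>n\<close>, all iterated partial derivatives of \<open>f\<close> of
  order at most \<open>k\<close> exist and are continuous. As \<open>U\<close> is open in \<open>\<real>\<^sup>n\<close> and only indices
  \<open>i < n\<close> occur, this depends only on the values of \<open>f\<close> on \<open>U\<close>.
\<close>

primrec Ck_on :: "nat \<Rightarrow> nat \<Rightarrow> (nat \<Rightarrow> real) set \<Rightarrow> ((nat \<Rightarrow> real) \<Rightarrow> real) \<Rightarrow> bool" where
  "Ck_on 0 n U f \<longleftrightarrow> continuous_map (subtopology (Euclidean_space n) U) euclideanreal f"
| "Ck_on (Suc k) n U f \<longleftrightarrow>
     continuous_map (subtopology (Euclidean_space n) U) euclideanreal f \<and>
     (\<forall>i<n. (\<forall>x\<in>U. (\<lambda>t. f (x(i := t))) field_differentiable at (x i)) \<and>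
            Ck_on k n U (partial_deriv i f))"

definition smooth_fun_on :: "nat \<Rightarrow> (nat \<Rightarrow> real) set \<Rightarrow> ((nat \<Rightarrow> real) \<Rightarrow> real) \<Rightarrow> bool" where
  "smooth_fun_on n U f \<longleftrightarrow> (\<forall>k. Ck_on k n U f)"

definition smooth_domain_map ::
  "nat \<Rightarrow> (nat \<Rightarrow> real) set \<Rightarrow> nat \<Rightarrow> (nat \<Rightarrow> real) set \<Rightarrow> ((nat \<Rightarrow> real) \<Rightarrow> (nat \<Rightarrow> real)) \<Rightarrow> bool"
  where
  "smooth_domain_map m W n U F \<longleftrightarrow> F ` W \<subseteq> U \<and> (\<forall>i<n. smooth_fun_on m W (\<lambda>x. F x i))"

text \<open>
  \<open>D n U p\<close> means that the restriction of \<open>p\<close> to the domain \<open>U\<close> of \<open>\<real>\<^sup>n\<close> is a plot. HOL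
  functions being total, the values of \<open>p\<close> outside \<open>U\<close> must be irrelevant; the sheaf
  condition below, which compares \<open>p\<close> with local plots \<open>q\<close> on \<open>W\<close> only, includes this.
\<close>

type_synonym 'a plots = "nat \<Rightarrow> (nat \<Rightarrow> real) set \<Rightarrow> ((nat \<Rightarrow> real) \<Rightarrow> 'a) \<Rightarrow> bool"

definition diffeology_on :: "'a set \<Rightarrow> 'a plots \<Rightarrow> bool" where
  "diffeology_on X D \<longleftrightarrow>
     (\<forall>n U p. D n U p \<longrightarrow> domain_in n U \<and> p ` U \<subseteq> X) \<and>
     (\<forall>n U c. domain_in n U \<and> c \<in> X \<longrightarrow> D n U (\<lambda>_. c)) \<and>
     (\<forall>n U p m W F. D n U p \<and> domain_in m W \<and> smooth_domain_map m W n U F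
        \<longrightarrow> D m W (p \<circ> F)) \<and>
     (\<forall>n U p. domain_in n U \<and>
        (\<forall>x\<in>U. \<exists>W q. domain_in n W \<and> x \<in> W \<and> W \<subseteq> U \<and> D n W q \<and> (\<forall>y\<in>W. p y = q y))
        \<longrightarrow> D n U p)"

definition diff_smooth :: "'a plots \<Rightarrow> 'b plots \<Rightarrow> ('a \<Rightarrow> 'b) \<Rightarrow> bool" where
  "diff_smooth D E f \<longleftrightarrow> (\<forall>n U p. D n U p \<longrightarrow> E n U (f \<circ> p))"

definition standard_diffeology :: "real plots" where
  "standard_diffeology n U p \<longleftrightarrow> domain_in n U \<and> smooth_fun_on n U p"

definition product_diffeology :: "'a plots \<Rightarrow> 'b plots \<Rightarrow> ('a \<times> 'b) plots" where
  "product_diffeology D E n U p \<longleftrightarrow> D n U (fst \<circ> p) \<and> E n U (snd \<circ> p)"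

definition subset_diffeology :: "'a plots \<Rightarrow> 'a set \<Rightarrow> 'a plots" where
  "subset_diffeology D W n U p \<longleftrightarrow> D n U p \<and> p ` U \<subseteq> W"

definition diffeological_vector_space :: "'a::real_vector plots \<Rightarrow> bool" where
  "diffeological_vector_space D \<longleftrightarrow>
     diffeology_on UNIV D \<and>
     diff_smooth (product_diffeology D D) D (\<lambda>(v, w). v + w) \<and>
     diff_smooth (product_diffeology standard_diffeology D) D (\<lambda>(r, v). r *\<^sub>R v)"

definition maximal_isotropic :: "'a::real_vector plots \<Rightarrow> 'a set" where
  "maximal_isotropic D =
     (\<Inter>f \<in> {f. linear f \<and> diff_smooth D standard_diffeology f}. {v. f v = 0})"

definition direct_sum_decomp :: "'a::real_vector set \<Rightarrow> 'a set \<Rightarrow> bool" where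
  "direct_sum_decomp V1 V2 \<longleftrightarrow>
     subspace V1 \<and> subspace V2 \<and> {a + b | a b. a \<in> V1 \<and> b \<in> V2} = UNIV \<and> V1 \<inter> V2 = {0}"

text \<open>
  The product diffeology lives on pairs; it is carried over to the whole space along
  \<open>(a, b) \<mapsto> a + b\<close>, which is bijective on \<open>V1 \<times> V2\<close> for a direct sum.
\<close>

definition smooth_direct_sum :: "'a::real_vector plots \<Rightarrow> 'a set \<Rightarrow> 'a set \<Rightarrow> bool" where
  "smooth_direct_sum D V1 V2 \<longleftrightarrow>
     direct_sum_decomp V1 V2 \<and>
     (\<forall>n U p. D n U p \<longleftrightarrow>
        (\<exists>q. product_diffeology (subset_diffeology D V1) (subset_diffeology D V2) n U q \<and>
             (\<forall>x\<in>U. p x = fst (q x) + snd (q x))))"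

end

theory Submission
  imports Defs
begin

text \<open>
  Since the codimension of the maximal isotropic subspace is positive, there are a smooth linear
  functional \<open>f\<close> and a vector \<open>w\<close> with \<open>f w = 1\<close>; since its dimension is positive, it contains some
  \<open>v0 \<noteq> 0\<close>, on which every smooth linear functional vanishes. As \<open>f\<close> separates \<open>w\<close> from \<open>v0\<close>, these
  two vectors are independent, and some linear functional \<open>h\<close> takes the value \<open>1\<close> on both. The
  decomposition sought is that of the space into the kernel of \<open>h\<close> and the line spanned by \<open>w\<close>.

  If it were smooth, the projection \<open>v \<mapsto> h v *\<^sub>R w\<close> onto the line would carry plots to plots.
  But \<open>f\<close> composed with this projection is \<open>h\<close>, so \<open>h\<close> would be smooth
  (lemma \<open>smooth_functional_of_smooth_kernel_line_sum\<close>). This is impossible, because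
  \<open>h v0 = 1 \<noteq> 0\<close> although \<open>v0\<close> lies in the maximal isotropic subspace.
\<close>

text \<open>This is the sheaf condition, with the whole domain as the single neighbourhood.\<close>

lemma plot_cong:
  assumes "diffeology_on X D" "D n U q" "\<And>x. x \<in> U \<Longrightarrow> p x = q x"
  shows "D n U p"
proof -
  have dom: "domain_in n U"
    using assms(1,2) unfolding diffeology_on_def by blast
  have sheaf: "\<forall>n U p. domain_in n U \<and>
        (\<forall>x\<in>U. \<exists>W q. domain_in n W \<and> x \<in> W \<and> W \<subseteq> U \<and> D n W q \<and> (\<forall>y\<in>W. p y = q y))
        \<longrightarrow> D n U p"
    using assms(1) unfolding diffeology_on_def by (elim conjE)
  have "\<forall>x\<in>U. \<exists>W q. domain_in n W \<and> x \<in> W \<and> W \<subseteq> U \<and> D n W q \<and> (\<forall>y\<in>W. p y = q y)"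
    using dom assms(2,3) by blast
  with sheaf dom show ?thesis
    by blast
qed

lemma direct_sum_kernel_line:
  fixes h :: "'a::real_vector \<Rightarrow> real"
  assumes h: "linear h" and hw: "h w = 1"
  shows "direct_sum_decomp {v. h v = 0} (span {w})"
  unfolding direct_sum_decomp_def
proof (intro conjI)
  show "subspace {v. h v = 0}"
    using linear_subspace_kernel[OF h] .
  show "subspace (span {w})"
    by simp
  have "\<exists>a b. v = a + b \<and> a \<in> {v. h v = 0} \<and> b \<in> span {w}" for v
  proof (intro exI conjI)
    show "v = (v - h v *\<^sub>R w) + h v *\<^sub>R w"
      by simp
    show "v - h v *\<^sub>R w \<in> {v. h v = 0}"
      using h hw by (simp add: linear_diff linear_scale)
    show "h v *\<^sub>R w \<in> span {w}"
      by (simp add: span_base span_scale)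
  qed
  then show "{a + b |a b. a \<in> {v. h v = 0} \<and> b \<in> span {w}} = UNIV"
    by blast
  show "{v. h v = 0} \<inter> span {w} = {0}"
    using h hw by (auto simp: span_singleton linear_scale linear_0)
qed

text \<open>
  The functional \<open>f\<close> identifies the line spanned by \<open>w\<close>, with its subset diffeology, with the
  standard \<open>\<real>\<close>. So smoothness of the decomposition, which makes the projection to the line smooth,
  makes the coordinate \<open>h\<close> of this projection smooth.
\<close>

lemma smooth_functional_of_smooth_kernel_line_sum:
  fixes D :: "'a::real_vector plots"
  assumes D: "diffeology_on UNIV D"
    and f: "linear f" "diff_smooth D standard_diffeology f" and fw: "f w = 1"
    and h: "linear h" and hw: "h w = 1"
    and sum: "smooth_direct_sum D {v. h v = 0} (span {w})"
  shows "diff_smooth D standard_diffeology h"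
  unfolding diff_smooth_def
proof (intro allI impI)
  fix n U p
  assume "D n U p"
  then obtain q where
    q: "product_diffeology (subset_diffeology D {v. h v = 0}) (subset_diffeology D (span {w})) n U q"
    and pq: "\<forall>x\<in>U. p x = fst (q x) + snd (q x)"
    using sum unfolding smooth_direct_sum_def by blast
  have plot: "D n U (snd \<circ> q)"
    using q by (simp add: product_diffeology_def subset_diffeology_def)
  have projection: "h (p x) *\<^sub>R w = (snd \<circ> q) x" if "x \<in> U" for x
  proof -
    have ker: "h (fst (q x)) = 0" and line: "snd (q x) \<in> span {w}"
      using q that by (auto simp: product_diffeology_def subset_diffeology_def)
    from line obtain c where c: "snd (q x) = c *\<^sub>R w"
      by (auto simp: span_singleton)
    have "h (p x) = c"
      using pq that ker c h hw by (simp add: linear_add linear_scale)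
    with c show ?thesis
      by simp
  qed
  \<comment> \<open>Values off \<open>U\<close> are arbitrary, so \<open>snd \<circ> q\<close> is replaced by the everywhere defined
    projection of \<open>p\<close>; then \<open>f\<close> recovers \<open>h \<circ> p\<close> as a function and not only on \<open>U\<close>.\<close>
  have "D n U (\<lambda>x. h (p x) *\<^sub>R w)"
    using plot_cong[OF D plot projection] .
  then have "standard_diffeology n U (f \<circ> (\<lambda>x. h (p x) *\<^sub>R w))"
    using f(2) unfolding diff_smooth_def by blast
  moreover have "f \<circ> (\<lambda>x. h (p x) *\<^sub>R w) = h \<circ> p"
    using f(1) fw by (auto simp: linear_scale)
  ultimately show "standard_diffeology n U (h \<circ> p)"
    by simp
qed

theorem corollary3p2:
  fixes D :: "'a::real_vector plots"
  assumes "diffeological_vector_space D"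
    and "\<exists>B::'a set. finite B \<and> span B = UNIV"
    and "dim (maximal_isotropic D) > 0"
    and "dim (UNIV :: 'a set) - dim (maximal_isotropic D) > 0"
  shows "\<exists>V1 V2. direct_sum_decomp V1 V2 \<and> \<not> smooth_direct_sum D V1 V2"
proof -
  have D: "diffeology_on UNIV D"
    using assms(1) by (simp add: diffeological_vector_space_def)
  have "maximal_isotropic D \<noteq> UNIV"
    using assms(4) by auto
  then obtain f u where f: "linear f" "diff_smooth D standard_diffeology f" and fu: "f u \<noteq> 0"
    unfolding maximal_isotropic_def by auto
  define w where "w = (1 / f u) *\<^sub>R u"
  have fw: "f w = 1"
    using f(1) fu by (simp add: w_def linear_scale)
  have "\<not> maximal_isotropic D \<subseteq> {0}"
  proof
    assume "maximal_isotropic D \<subseteq> {0}"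
    then have "maximal_isotropic D \<subseteq> span {}"
      by simp
    then have "dim (maximal_isotropic D) \<le> card ({} :: 'a set)"
      by (rule dim_le_card) simp
    with assms(3) show False
      by simp
  qed
  then obtain v0 where v0: "v0 \<in> maximal_isotropic D" "v0 \<noteq> 0"
    by blast
  have isotropic: "g v0 = 0" if "linear g" "diff_smooth D standard_diffeology g" for g
    using v0(1) that unfolding maximal_isotropic_def by blast
  have "w \<notin> span {v0}"
    using fw f(1) isotropic[OF f] by (auto simp: span_singleton linear_scale)
  then have "independent {w, v0}"
    using v0(2) by (simp add: independent_insert)
  then obtain h :: "'a \<Rightarrow> real" where h: "linear h" "h w = 1" "h v0 = 1"
    using linear_independent_extend[of "{w, v0}" "\<lambda>_. 1"] by auto
  have "\<not> smooth_direct_sum D {v. h v = 0} (span {w})"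
    using smooth_functional_of_smooth_kernel_line_sum[OF D f fw h(1,2)] isotropic[OF h(1)] h(3)
    by auto
  with direct_sum_kernel_line[OF h(1,2)] show ?thesis
    by blast
qed

end
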